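(* Let $\mathcal{A}=\mathcal{A}_{k_1,\ldots,k_p}$ and $\mathcal{B}=\mathcal{A}_{l_1,\ldots,l_q}$ be block upper-triangular subalgebras of $M_n$. Then: (a) $\mathcal{A}$ and $\mathcal{B}$ are algebra-isomorphic if and only if $(k_1,\ldots,k_p) = (l_1,\ldots,l_q)$. (b) $\mathcal{A}$ and $\mathcal{B}$ are algebra-antiisomorphic if and only if $(k_1,\ldots,k_p) = (l_q,\ldots,l_1)$. (c) $\mathcal{A}$ and $\mathcal{B}$ are Jordan-isomorphic if and only if $(k_1,\ldots,k_p) = (l_1,\ldots,l_q)$ or $(k_1,\ldots,k_p)=(l_q,\ldots,l_1)$.
   Context: $n$ is a positive integer, $M_n$ is the algebra of $n\times n$ complex matrices and $M_{p,q}$ is the space of $p\times q$ complex matrices. For $r,k_1,\ldots,k_r\in\mathbb{N}$ (positive integers) with $k_1+\cdots+k_r=n$, the block upper-triangular algebra $\mathcal{A}_{k_1,\ldots,k_r}\subseteq M_n$ consists of all matrices partitioned into blocks $(X_{ij})_{1\le i,j\le r}$ with $X_{ij}\in M_{k_i,k_j}$ and $X_{ij}=0$ for $i>j$. Algebra isomorphisms (antiisomorphisms) are linear bijections that are multiplicative (antimultiplicative, i.e. $\phi(ab)=\phi(b)\phi(a)$). A Jordan isomorphism is a linear bijection $\phi$ such that $\phi(a\circ b)=\phi(a)\circ\phi(b)$ for all $a,b$, where $x\circ y=xy+yx$. Equality of tuples such as $(k_1,\ldots,k_p) = (l_1,\ldots,l_q)$ includes $p=q$. *)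

theory Defs
  imports Complex_Main "Jordan_Normal_Form.Matrix"
begin

text \<open>
  A tuple \<open>(k_1, ..., k_r)\<close> of positive integers with sum \<open>n\<close> is a list; list and matrix
  indices start at 0.
\<close>

definition composition_of :: "nat list \<Rightarrow> nat \<Rightarrow> bool" where
  "composition_of ks n \<longleftrightarrow> (\<forall>k \<in> set ks. 0 < k) \<and> sum_list ks = n"

definition block_offset :: "nat list \<Rightarrow> nat \<Rightarrow> nat" where
  "block_offset ks i = sum_list (take i ks)"

definition block :: "nat list \<Rightarrow> complex mat \<Rightarrow> nat \<Rightarrow> nat \<Rightarrow> complex mat" where
  "block ks X i j =
     mat (ks ! i) (ks ! j) (\<lambda>(a, b). X $$ (block_offset ks i + a, block_offset ks j + b))"

definition block_upper_triangular :: "nat list \<Rightarrow> complex mat set" where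
  "block_upper_triangular ks =
     {X \<in> carrier_mat (sum_list ks) (sum_list ks).
        \<forall>i < length ks. \<forall>j < i. block ks X i j = 0\<^sub>m (ks ! i) (ks ! j)}"

text \<open>
  Maps between subalgebras are total functions on the matrix type of which only the values
  on the domain \<open>A\<close> matter.
\<close>

definition linear_bij :: "complex mat set \<Rightarrow> complex mat set \<Rightarrow> (complex mat \<Rightarrow> complex mat) \<Rightarrow> bool"
  where
  "linear_bij A B \<phi> \<longleftrightarrow>
     bij_betw \<phi> A B \<and>
     (\<forall>X \<in> A. \<forall>Y \<in> A. \<phi> (X + Y) = \<phi> X + \<phi> Y) \<and>
     (\<forall>c. \<forall>X \<in> A. \<phi> (c \<cdot>\<^sub>m X) = c \<cdot>\<^sub>m \<phi> X)"

definition jordan_prod :: "complex mat \<Rightarrow> complex mat \<Rightarrow> complex mat" where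
  "jordan_prod X Y = X * Y + Y * X"

definition algebra_isomorphic :: "complex mat set \<Rightarrow> complex mat set \<Rightarrow> bool" where
  "algebra_isomorphic A B \<longleftrightarrow>
     (\<exists>\<phi>. linear_bij A B \<phi> \<and> (\<forall>X \<in> A. \<forall>Y \<in> A. \<phi> (X * Y) = \<phi> X * \<phi> Y))"

definition algebra_antiisomorphic :: "complex mat set \<Rightarrow> complex mat set \<Rightarrow> bool" where
  "algebra_antiisomorphic A B \<longleftrightarrow>
     (\<exists>\<phi>. linear_bij A B \<phi> \<and> (\<forall>X \<in> A. \<forall>Y \<in> A. \<phi> (X * Y) = \<phi> Y * \<phi> X))"

definition jordan_isomorphic :: "complex mat set \<Rightarrow> complex mat set \<Rightarrow> bool" where
  "jordan_isomorphic A B \<longleftrightarrow>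
     (\<exists>\<phi>. linear_bij A B \<phi> \<and>
        (\<forall>X \<in> A. \<forall>Y \<in> A. \<phi> (jordan_prod X Y) = jordan_prod (\<phi> X) (\<phi> Y)))"

end

theory Submission
  imports Defs "Jordan_Normal_Form.Determinant"
begin

text \<open>
  Write a block upper-triangular algebra as the matrices \<open>X\<close> with \<open>X\<^sub>a\<^sub>b = 0\<close> whenever
  \<open>b < s \<le> a\<close> for some partial sum (cut) \<open>s\<close> of its block sizes. A Jordan isomorphism maps the
  diagonal matrix units \<open>E\<^sub>i\<^sub>i\<close> to \<open>n\<close> nonzero orthogonal idempotents \<open>f\<^sub>i\<close>. For every cut \<open>s\<close>, a
  rank count shows that exactly \<open>s\<close> of them live in the upper left corner of size \<open>s\<close> and the
  others in the lower right one. Hence the preorder \<open>i \<le> j \<longleftrightarrow> f\<^sub>i B f\<^sub>j \<noteq> 0\<close> has the nonzero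
  cuts as the cardinalities of its principal down-sets. An isomorphism preserves this preorder,
  an antiisomorphism reverses it. A Jordan isomorphism preserves betweenness, because the Jordan
  product of the Peirce spaces of \<open>f\<^sub>i, f\<^sub>j\<close> and of \<open>f\<^sub>j, f\<^sub>k\<close> is nonzero iff \<open>j\<close> lies between
  \<open>i\<close> and \<open>k\<close>; and betweenness determines a total preorder up to reversal.
\<close>

section \<open>Matrices that respect a set of cuts\<close>

lemma index_mult_mat_sum:
  assumes "A \<in> carrier_mat n n" "B \<in> carrier_mat n n" "a < n" "b < n"
  shows "(A * B) $$ (a, b) = (\<Sum>c<n. A $$ (a, c) * B $$ (c, b))"
  using assms by (simp add: scalar_prod_def lessThan_atLeast0)

lemma mult_mat_entry_nonzero:
  fixes A B :: "'a :: semiring_0 mat"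
  assumes "A \<in> carrier_mat n n" "B \<in> carrier_mat n n" "a < n" "b < n" "(A * B) $$ (a, b) \<noteq> 0"
  obtains c where "c < n" "A $$ (a, c) \<noteq> 0" "B $$ (c, b) \<noteq> 0"
proof -
  have "(\<Sum>c<n. A $$ (a, c) * B $$ (c, b)) \<noteq> 0"
    using assms by (simp only: index_mult_mat_sum[symmetric]) simp
  then obtain c where "c < n" "A $$ (a, c) * B $$ (c, b) \<noteq> 0"
    by (meson lessThan_iff sum.not_neutral_contains_not_neutral)
  then show thesis using that by (metis mult_zero_left mult_zero_right)
qed

lemma nonzero_mat_entry:
  assumes "A \<in> carrier_mat n m" "A \<noteq> 0\<^sub>m n m"
  obtains a b where "a < n" "b < m" "A $$ (a, b) \<noteq> 0"
  using assms by (metis carrier_matD eq_matI index_zero_mat)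

definition unit_mat :: "nat \<Rightarrow> nat \<Rightarrow> nat \<Rightarrow> 'a :: zero_neq_one mat" where
  "unit_mat n c d = mat n n (\<lambda>(a, b). if a = c \<and> b = d then 1 else 0)"

lemma unit_mat_carrier [simp]: "unit_mat n c d \<in> carrier_mat n n"
  by (simp add: unit_mat_def)

text \<open>A matrix unit between two factors reduces the sum to a single product. Hence a nonzero
  entry of \<open>A\<close> in column \<open>c\<close> and one of \<open>B\<close> in row
  \<open>d\<close> already make the sandwich nonzero; all later nonvanishing witnesses are built
  this way.\<close>

lemma index_mult_unit_mat:
  fixes A B :: "'a :: semiring_1 mat"
  assumes "A \<in> carrier_mat n n" "B \<in> carrier_mat n n" "a < n" "b < n" "c < n" "d < n"
  shows "(A * unit_mat n c d * B) $$ (a, b) = A $$ (a, c) * B $$ (d, b)"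
proof -
  have *: "(A * unit_mat n c d) $$ (a, x) = (if x = d then A $$ (a, c) else 0)" if "x < n" for x
  proof -
    have "(A * unit_mat n c d) $$ (a, x)
        = (\<Sum>y<n. A $$ (a, y) * unit_mat n c d $$ (y, x))"
      using assms that by (intro index_mult_mat_sum) auto
    also have "\<dots> = (\<Sum>y<n. if y = c then (if x = d then A $$ (a, c) else 0) else 0)"
      using that by (intro sum.cong) (auto simp: unit_mat_def)
    also have "\<dots> = (if x = d then A $$ (a, c) else 0)"
      using assms by simp
    finally show ?thesis .
  qed
  have "(A * unit_mat n c d * B) $$ (a, b) = (\<Sum>x<n. (A * unit_mat n c d) $$ (a, x) * B $$ (x, b))"
    using assms by (intro index_mult_mat_sum) auto
  also have "\<dots> = (\<Sum>x<n. if x = d then A $$ (a, c) * B $$ (d, b) else 0)"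
    using * by (intro sum.cong) auto
  also have "\<dots> = A $$ (a, c) * B $$ (d, b)"
    using assms by simp
  finally show ?thesis .
qed

text \<open>Cuts replace block indices so that products can be handled by chasing the support of
  single entries, and so that reversing the list of block sizes becomes the reflection of
  \<open>s\<close> to \<open>n - s\<close>.\<close>

definition cut_algebra :: "nat \<Rightarrow> nat set \<Rightarrow> complex mat set" where
  "cut_algebra n C =
     {X \<in> carrier_mat n n. \<forall>s\<in>C. \<forall>a b. b < s \<longrightarrow> s \<le> a \<longrightarrow> a < n \<longrightarrow> X $$ (a, b) = 0}"

lemma cut_algebra_carrier: "X \<in> cut_algebra n C \<Longrightarrow> X \<in> carrier_mat n n"
  by (simp add: cut_algebra_def)

lemma cut_algebra_entry:
  "X \<in> cut_algebra n C \<Longrightarrow> X $$ (a, b) \<noteq> 0 \<Longrightarrow> s \<in> C \<Longrightarrow> b < s \<Longrightarrow> a < n \<Longrightarrow> a < s"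
  unfolding cut_algebra_def by (simp add: linorder_not_le[symmetric]) blast

lemma cut_algebra_zero: "C \<subseteq> {..n} \<Longrightarrow> 0\<^sub>m n n \<in> cut_algebra n C"
  by (auto simp: cut_algebra_def)

lemma cut_algebra_add:
  assumes "C \<subseteq> {..n}" "X \<in> cut_algebra n C" "Y \<in> cut_algebra n C"
  shows "X + Y \<in> cut_algebra n C"
proof -
  have "(X + Y) $$ (a, b) = 0" if "s \<in> C" "b < s" "s \<le> a" "a < n" for s a b
  proof -
    have "X $$ (a, b) = 0" "Y $$ (a, b) = 0"
      using assms(2,3) that unfolding cut_algebra_def by blast+
    moreover have "b < n" using assms(1) that by auto
    ultimately show ?thesis
      using that cut_algebra_carrier[OF assms(2)] cut_algebra_carrier[OF assms(3)] by auto
  qed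
  then show ?thesis
    using cut_algebra_carrier[OF assms(2)] cut_algebra_carrier[OF assms(3)]
    by (auto simp: cut_algebra_def)
qed

lemma cut_algebra_mult:
  assumes "C \<subseteq> {..n}" "X \<in> cut_algebra n C" "Y \<in> cut_algebra n C"
  shows "X * Y \<in> cut_algebra n C"
proof -
  note X = cut_algebra_carrier[OF assms(2)] and Y = cut_algebra_carrier[OF assms(3)]
  have "(X * Y) $$ (a, b) = 0" if "s \<in> C" "b < s" "s \<le> a" "a < n" for s a b
  proof (rule ccontr)
    assume nz: "(X * Y) $$ (a, b) \<noteq> 0"
    have "b < n" using assms(1) that by auto
    then obtain c where "c < n" "X $$ (a, c) \<noteq> 0" "Y $$ (c, b) \<noteq> 0"
      using mult_mat_entry_nonzero[OF X Y \<open>a < n\<close> _ nz] by blast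
    then have "a < s"
      using cut_algebra_entry assms(2,3) that by blast
    then show False using that by simp
  qed
  then show ?thesis
    using X Y by (auto simp: cut_algebra_def)
qed

lemma cut_algebra_jordan_prod:
  "C \<subseteq> {..n} \<Longrightarrow> X \<in> cut_algebra n C \<Longrightarrow> Y \<in> cut_algebra n C \<Longrightarrow> jordan_prod X Y \<in> cut_algebra n C"
  by (simp add: jordan_prod_def cut_algebra_add cut_algebra_mult)

lemma unit_mat_cut_algebra:
  assumes "C \<subseteq> {..n}" "\<And>s. s \<in> C \<Longrightarrow> d < s \<Longrightarrow> c < s"
  shows "unit_mat n c d \<in> cut_algebra n C"
proof -
  have "unit_mat n c d $$ (a, b) = (0 :: complex)" if "s \<in> C" "b < s" "s \<le> a" "a < n" for s a b
  proof -
    have "b < n" using assms(1) that by auto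
    moreover have "\<not> (a = c \<and> b = d)" using assms(2)[OF that(1)] that by auto
    ultimately show ?thesis using that by (auto simp: unit_mat_def)
  qed
  then show ?thesis by (auto simp: cut_algebra_def)
qed

section \<open>Frames of orthogonal idempotents\<close>

text \<open>Fix a nonzero entry of each \<open>g i\<close>. The column of each \<open>g j\<close>
  through its entry and the rescaled row of each \<open>g i\<close> through its entry multiply to
  the identity of size \<open>card I\<close>, with inner index in \<open>S\<close>. If
  \<open>S\<close> were smaller, zero padding would make both factors square, so they would be
  inverse to each other although one has a zero row. Stating this for functions lets
  \<open>S\<close> be the index range of a diagonal corner.\<close>

lemma card_orthogonal_idempotents_le:
  fixes g :: "'i \<Rightarrow> 'b \<Rightarrow> 'b \<Rightarrow> 'a :: field"
  assumes fin: "finite I" "finite S"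
    and orth: "\<And>i j a b. i \<in> I \<Longrightarrow> j \<in> I \<Longrightarrow> a \<in> S \<Longrightarrow> b \<in> S \<Longrightarrow>
      (\<Sum>c\<in>S. g i a c * g j c b) = (if i = j then g i a b else 0)"
    and nz: "\<And>i. i \<in> I \<Longrightarrow> \<exists>a\<in>S. \<exists>b\<in>S. g i a b \<noteq> 0"
  shows "card I \<le> card S"
proof (rule ccontr)
  assume "\<not> card I \<le> card S"
  define m where "m = card I"
  have less: "card S < m"
    using \<open>\<not> card I \<le> card S\<close> by (simp add: m_def)
  obtain h where h: "bij_betw h {..<m} I"
    using fin(1) by (metis atLeast0LessThan ex_bij_betw_nat_finite m_def)
  obtain k where k: "bij_betw k {..<card S} S"
    using fin(2) by (metis atLeast0LessThan ex_bij_betw_nat_finite)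
  obtain p q where pq: "\<And>i. i \<in> I \<Longrightarrow> p i \<in> S \<and> q i \<in> S \<and> g i (p i) (q i) \<noteq> 0"
    using nz by metis
  define U where "U = mat m m (\<lambda>(r, j). if r < card S then g (h j) (k r) (q (h j)) else 0)"
  define V where "V = mat m m (\<lambda>(i, r). if r < card S
      then g (h i) (p (h i)) (k r) / g (h i) (p (h i)) (q (h i)) else 0)"
  have U: "U \<in> carrier_mat m m" and V: "V \<in> carrier_mat m m"
    by (simp_all add: U_def V_def)
  have "V * U = 1\<^sub>m m"
  proof (rule eq_matI)
    fix i j assume "i < dim_row (1\<^sub>m m)" "j < dim_col (1\<^sub>m m)"
    then have ij: "i < m" "j < m" by simp_all
    have hI: "h i \<in> I" "h j \<in> I" using h ij by (auto dest: bij_betwE)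
    have eq: "h i = h j \<longleftrightarrow> i = j"
      using h ij by (metis bij_betw_def inj_on_eq_iff lessThan_iff)
    let ?d = "g (h i) (p (h i)) (q (h i))"
    have "(V * U) $$ (i, j) = (\<Sum>r<m. V $$ (i, r) * U $$ (r, j))"
      using ij by (rule index_mult_mat_sum[OF V U])
    also have "\<dots> = (\<Sum>r<card S. V $$ (i, r) * U $$ (r, j))"
      using less ij by (intro sum.mono_neutral_right) (auto simp: U_def)
    also have "\<dots> = (\<Sum>r<card S. g (h i) (p (h i)) (k r) * g (h j) (k r) (q (h j)) / ?d)"
      using less ij by (intro sum.cong) (auto simp: U_def V_def)
    also have "\<dots> = (\<Sum>c\<in>S. g (h i) (p (h i)) c * g (h j) c (q (h j)) / ?d)"
      by (rule sum.reindex_bij_betw[OF k])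
    also have "\<dots> = (\<Sum>c\<in>S. g (h i) (p (h i)) c * g (h j) c (q (h j))) / ?d"
      by (simp add: sum_divide_distrib)
    also have "\<dots> = (if h i = h j then g (h i) (p (h i)) (q (h j)) else 0) / ?d"
      using orth[OF hI] pq hI by simp
    also have "\<dots> = 1\<^sub>m m $$ (i, j)"
      using eq ij pq hI by auto
    finally show "(V * U) $$ (i, j) = 1\<^sub>m m $$ (i, j)" .
  qed (use U V in auto)
  then have "U * V = 1\<^sub>m m"
    using mat_mult_left_right_inverse[OF V U] by simp
  \<comment> \<open>Row \<open>card S\<close> of \<open>U\<close> exists because
    \<open>card S < m\<close>, and it consists of padding.\<close>
  moreover have "(U * V) $$ (card S, card S) = (\<Sum>r<m. U $$ (card S, r) * V $$ (r, card S))"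
    using less by (intro index_mult_mat_sum[OF U V])
  moreover have "\<dots> = 0"
    using less by (intro sum.neutral) (auto simp: U_def)
  ultimately show False using less by simp
qed

text \<open>Since \<open>jordan_prod\<close> carries no factor 1/2, these equations describe the
  common Peirce 1/2-space of \<open>f i\<close> and \<open>f j\<close>, which for distinct members
  of a frame is \<open>f i A f j + f j A f i\<close>. The Jordan formulation is what a Jordan
  isomorphism transports.\<close>

definition peirce :: "complex mat set \<Rightarrow> (nat \<Rightarrow> complex mat) \<Rightarrow> nat \<Rightarrow> nat \<Rightarrow> complex mat set" where
  "peirce A f i j = {x \<in> A. jordan_prod x (f i) = x \<and> jordan_prod x (f j) = x}"

text \<open>The number of idempotents equals the matrix size, which makes the later rank counts
  tight. The diagonal matrix units are one instance, and their images under a Jordan isomorphism are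
  another.\<close>

locale idempotent_frame =
  fixes n :: nat and C :: "nat set" and f :: "nat \<Rightarrow> complex mat"
  assumes cuts: "C \<subseteq> {..n}" "0 \<in> C" "n \<in> C"
    and in_alg: "i < n \<Longrightarrow> f i \<in> cut_algebra n C"
    and orth: "i < n \<Longrightarrow> j < n \<Longrightarrow> f i * f j = (if i = j then f i else 0\<^sub>m n n)"
    and nonzero: "i < n \<Longrightarrow> f i \<noteq> 0\<^sub>m n n"
begin

text \<open>At a cut, taking a diagonal corner is multiplicative. So \<open>upper s i\<close> says
  that \<open>f i\<close> induces a nonzero idempotent on the first \<open>s\<close> coordinates,
  and \<open>lower s i\<close> that it does so on the remaining ones.\<close>

definition upper :: "nat \<Rightarrow> nat \<Rightarrow> bool" where
  "upper s i \<longleftrightarrow> (\<exists>a<s. \<exists>b<s. f i $$ (a, b) \<noteq> 0)"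

definition lower :: "nat \<Rightarrow> nat \<Rightarrow> bool" where
  "lower s i \<longleftrightarrow> (\<exists>a\<in>{s..<n}. \<exists>b\<in>{s..<n}. f i $$ (a, b) \<noteq> 0)"

definition linked :: "nat \<Rightarrow> nat \<Rightarrow> bool" where
  "linked i j \<longleftrightarrow> (\<exists>x \<in> cut_algebra n C. f i * x * f j \<noteq> 0\<^sub>m n n)"

lemma carrier: "i < n \<Longrightarrow> f i \<in> carrier_mat n n"
  using in_alg cut_algebra_carrier by blast

lemma cut_le: "s \<in> C \<Longrightarrow> s \<le> n"
  using cuts by auto

lemma entry: "i < n \<Longrightarrow> f i $$ (a, b) \<noteq> 0 \<Longrightarrow> s \<in> C \<Longrightarrow> b < s \<Longrightarrow> a < n \<Longrightarrow> a < s"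
  using in_alg cut_algebra_entry by blast

lemma orth_sum:
  assumes "i < n" "j < n" "a < n" "b < n"
  shows "(\<Sum>c<n. f i $$ (a, c) * f j $$ (c, b)) = (if i = j then f i $$ (a, b) else 0)"
  using index_mult_mat_sum[OF carrier carrier, OF assms] orth[OF assms(1,2)] assms by auto

text \<open>A matrix supported in the upper right corner squares to zero, so a nonzero idempotent
  has to meet a diagonal corner. The middle index \<open>c\<close> of a nonzero term of
  \<open>f i * f i\<close> decides which one.\<close>

lemma upper_or_lower:
  assumes "i < n" "s \<in> C"
  shows "upper s i \<or> lower s i"
proof -
  obtain a b where ab: "a < n" "b < n" "f i $$ (a, b) \<noteq> 0"
    using nonzero_mat_entry[OF carrier nonzero] assms by blast
  have "(f i * f i) $$ (a, b) \<noteq> 0" using ab orth assms by simp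
  then obtain c where c: "c < n" "f i $$ (a, c) \<noteq> 0" "f i $$ (c, b) \<noteq> 0"
    using mult_mat_entry_nonzero[OF carrier carrier] ab assms by blast
  show ?thesis
  proof (cases "c < s")
    case True
    then have "a < s" using entry assms c ab by blast
    then show ?thesis using True c by (auto simp: upper_def)
  next
    case False
    then have "s \<le> b" using entry[of i c b s] assms c ab by force
    then show ?thesis using False c ab by (auto simp: lower_def)
  qed
qed

text \<open>For a column \<open>b < s\<close> the entries of \<open>f j\<close> in rows from
  \<open>s\<close> on vanish, so the sum over all inner indices collapses to the corner, and the
  corners inherit the orthogonality relations.\<close>

lemma card_upper_le:
  assumes "s \<in> C"
  shows "card {i. i < n \<and> upper s i} \<le> s"
proof -
  have "card {i. i < n \<and> upper s i} \<le> card {..<s}"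
  proof (rule card_orthogonal_idempotents_le[where g = "\<lambda>i a b. f i $$ (a, b)"])
    fix i j a b
    assume *: "i \<in> {i. i < n \<and> upper s i}" "j \<in> {i. i < n \<and> upper s i}" "a \<in> {..<s}" "b \<in> {..<s}"
    have z: "f i $$ (a, c) * f j $$ (c, b) = 0" if "c < n" "\<not> c < s" for c
      using entry[of j c b s] that * assms by auto
    then have "(\<Sum>c\<in>{..<s}. f i $$ (a, c) * f j $$ (c, b)) = (\<Sum>c<n. f i $$ (a, c) * f j $$ (c, b))"
      using cut_le[OF assms] by (intro sum.mono_neutral_left) (auto simp: z simp del: mult_eq_0_iff)
    then show "(\<Sum>c\<in>{..<s}. f i $$ (a, c) * f j $$ (c, b)) = (if i = j then f i $$ (a, b) else 0)"
      using orth_sum[of i j a b] * cut_le[OF assms] by auto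
  qed (auto simp: upper_def)
  then show ?thesis by simp
qed

lemma card_lower_le:
  assumes "s \<in> C"
  shows "card {i. i < n \<and> lower s i} \<le> n - s"
proof -
  have "card {i. i < n \<and> lower s i} \<le> card {s..<n}"
  proof (rule card_orthogonal_idempotents_le[where g = "\<lambda>i a b. f i $$ (a, b)"])
    fix i j a b
    assume *: "i \<in> {i. i < n \<and> lower s i}" "j \<in> {i. i < n \<and> lower s i}" "a \<in> {s..<n}" "b \<in> {s..<n}"
    have z: "f i $$ (a, c) * f j $$ (c, b) = 0" if "c < s" for c
      using entry[of i a c s] that * assms by auto
    then have "(\<Sum>c\<in>{s..<n}. f i $$ (a, c) * f j $$ (c, b)) = (\<Sum>c<n. f i $$ (a, c) * f j $$ (c, b))"
      by (intro sum.mono_neutral_left) (auto simp: z not_le simp del: mult_eq_0_iff)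
    then show "(\<Sum>c\<in>{s..<n}. f i $$ (a, c) * f j $$ (c, b)) = (if i = j then f i $$ (a, b) else 0)"
      using orth_sum[of i j a b] * by auto
  qed (auto simp: lower_def)
  then show ?thesis by simp
qed

text \<open>The two diagonal corners at a cut leave room for only \<open>s + (n - s) = n\<close> idempotents, so
  both counts are exact and no idempotent meets both corners.\<close>

lemma card_upper: "s \<in> C \<Longrightarrow> card {i. i < n \<and> upper s i} = s"
  and upper_iff_not_lower: "s \<in> C \<Longrightarrow> i < n \<Longrightarrow> upper s i \<longleftrightarrow> \<not> lower s i"
proof -
  assume s: "s \<in> C"
  let ?U = "{i. i < n \<and> upper s i}" and ?L = "{i. i < n \<and> lower s i}"
  have "?U \<union> ?L = {..<n}" using upper_or_lower s by auto
  then have "card ?U + card ?L = n + card (?U \<inter> ?L)"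
    using card_Un_Int[of ?U ?L] by simp
  then have *: "card ?U = s" "card (?U \<inter> ?L) = 0"
    using card_upper_le[OF s] card_lower_le[OF s] cut_le[OF s] by linarith+
  show "card ?U = s" by fact
  have "?U \<inter> ?L = {}" using *(2) by (simp add: card_eq_0_iff)
  then show "upper s i \<longleftrightarrow> \<not> lower s i" if "i < n"
    using upper_or_lower s that by auto
qed

lemma upper_mono: "s \<le> t \<Longrightarrow> upper s i \<Longrightarrow> upper t i"
  unfolding upper_def by (meson order_less_le_trans)

text \<open>Both indices of a nonzero entry of \<open>f i\<close> can be placed in the diagonal block to which
  \<open>f i\<close> belongs: it is the middle factor of a nonzero term of \<open>f i * f i * f i\<close>.\<close>

lemma core_entry:
  assumes "i < n"
  obtains p q where "p < n" "q < n" "f i $$ (p, q) \<noteq> 0"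
    "\<And>s. s \<in> C \<Longrightarrow> p < s \<longleftrightarrow> upper s i" "\<And>s. s \<in> C \<Longrightarrow> q < s \<longleftrightarrow> upper s i"
proof -
  obtain a b where ab: "a < n" "b < n" "f i $$ (a, b) \<noteq> 0"
    using nonzero_mat_entry[OF carrier nonzero] assms by blast
  have "(f i * f i) $$ (a, b) \<noteq> 0" using ab orth assms by simp
  then obtain p where p: "p < n" "f i $$ (a, p) \<noteq> 0" "f i $$ (p, b) \<noteq> 0"
    using mult_mat_entry_nonzero[OF carrier carrier] ab assms by blast
  have "(f i * f i) $$ (p, b) \<noteq> 0" using p orth assms by simp
  then obtain q where q: "q < n" "f i $$ (p, q) \<noteq> 0" "f i $$ (q, b) \<noteq> 0"
    using mult_mat_entry_nonzero[OF carrier carrier] ab p assms by blast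
  \<comment> \<open>The three implications form a cycle, so all three conditions are
    equivalent.\<close>
  have *: "(p < s \<longrightarrow> upper s i) \<and> (upper s i \<longrightarrow> q < s) \<and> (q < s \<longrightarrow> p < s)" if "s \<in> C" for s
  proof (intro conjI impI)
    assume "p < s"
    then have "a < s" using entry assms that ab p by blast
    then show "upper s i" using \<open>p < s\<close> p by (auto simp: upper_def)
  next
    assume "upper s i"
    then have nl: "\<not> lower s i" using upper_iff_not_lower that assms by blast
    show "q < s"
    proof (rule ccontr)
      assume "\<not> q < s"
      then have "s \<le> b" using entry[of i q b s] assms that q by force
      then have "lower s i" using \<open>\<not> q < s\<close> q ab unfolding lower_def by force
      then show False using nl by simp
    qed
  next
    assume "q < s"
    then show "p < s" using entry assms that p q by blast
  qed
  show thesis by (rule that[OF p(1) q(1,2)]) (use * in blast)+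
qed

text \<open>A nonzero term of \<open>f i * x * f j\<close> lets triangularity at each cut be
  followed from right to left through its indices. Conversely, the matrix unit joining a core entry
  of \<open>f i\<close> to one of \<open>f j\<close> lies in the algebra and gives a nonzero
  product. Linkage thus becomes a statement about cuts alone.\<close>

lemma linked_iff:
  assumes "i < n" "j < n"
  shows "linked i j \<longleftrightarrow> (\<forall>s\<in>C. upper s j \<longrightarrow> upper s i)"
proof
  assume "linked i j"
  then obtain x where x: "x \<in> cut_algebra n C" "f i * x * f j \<noteq> 0\<^sub>m n n"
    by (auto simp: linked_def)
  note c = carrier[OF assms(1)] cut_algebra_carrier[OF x(1)] carrier[OF assms(2)]
  obtain a b where ab: "a < n" "b < n" "(f i * x * f j) $$ (a, b) \<noteq> 0"
    using nonzero_mat_entry[of "f i * x * f j" n n] x(2) c by auto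
  obtain e where e: "e < n" "(f i * x) $$ (a, e) \<noteq> 0" "f j $$ (e, b) \<noteq> 0"
    using mult_mat_entry_nonzero[OF _ c(3) ab] c by auto
  obtain d where d: "d < n" "f i $$ (a, d) \<noteq> 0" "x $$ (d, e) \<noteq> 0"
    using mult_mat_entry_nonzero[OF c(1,2) ab(1) e(1,2)] by blast
  show "\<forall>s\<in>C. upper s j \<longrightarrow> upper s i"
  proof (intro ballI impI)
    fix s assume s: "s \<in> C" "upper s j"
    have "e < s"
    proof (rule ccontr)
      assume "\<not> e < s"
      then have "s \<le> b" using entry[of j e b s] assms s e by force
      then have "lower s j" using \<open>\<not> e < s\<close> e ab unfolding lower_def by force
      then show False using upper_iff_not_lower s assms by blast
    qed
    then have "d < s" using cut_algebra_entry x d s by blast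
    moreover have "a < s" using entry calculation assms d s ab by blast
    ultimately show "upper s i" using d by (auto simp: upper_def)
  qed
next
  assume *: "\<forall>s\<in>C. upper s j \<longrightarrow> upper s i"
  obtain p q where pq: "p < n" "q < n" "f i $$ (p, q) \<noteq> 0" "\<And>s. s \<in> C \<Longrightarrow> q < s \<longleftrightarrow> upper s i"
    using core_entry[OF assms(1)] by metis
  obtain p' q' where pq': "p' < n" "q' < n" "f j $$ (p', q') \<noteq> 0" "\<And>s. s \<in> C \<Longrightarrow> p' < s \<longleftrightarrow> upper s j"
    using core_entry[OF assms(2)] by metis
  have "unit_mat n q p' \<in> cut_algebra n C"
    using cuts(1) pq pq' * by (intro unit_mat_cut_algebra) auto
  moreover have "(f i * unit_mat n q p' * f j) $$ (p, q') \<noteq> 0"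
    using index_mult_unit_mat[OF carrier carrier] assms pq pq' by simp
  then have "f i * unit_mat n q p' * f j \<noteq> 0\<^sub>m n n"
    using pq pq' by auto
  ultimately show "linked i j" by (auto simp: linked_def)
qed

lemma linked_trans: "linked i j \<Longrightarrow> linked j k \<Longrightarrow> i < n \<Longrightarrow> j < n \<Longrightarrow> k < n \<Longrightarrow> linked i k"
  using linked_iff by blast

text \<open>Cuts refuting the two directions are comparable, and monotonicity of
  \<open>upper\<close> carries the smaller one's witness up to the larger one, a
  contradiction.\<close>

lemma linked_total: "i < n \<Longrightarrow> j < n \<Longrightarrow> linked i j \<or> linked j i"
proof (rule ccontr)
  assume ij: "i < n" "j < n" and "\<not> (linked i j \<or> linked j i)"
  then obtain s t where "upper s j" "\<not> upper s i" "upper t i" "\<not> upper t j"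
    by (auto simp: linked_iff)
  then show False
    using upper_mono[of s t] upper_mono[of t s] by (meson nle_le)
qed

text \<open>The down-set of \<open>j\<close> is the set of all \<open>i\<close> with
  \<open>upper s i\<close>, where \<open>s\<close> is the least cut with \<open>upper s j\<close>;
  by \<open>card_upper\<close> it has \<open>s\<close> elements. Every nonzero cut is least for some
  \<open>j\<close>, because the count jumps between consecutive cuts.\<close>

lemma card_linked: "(\<lambda>j. card {i. i < n \<and> linked i j}) ` {..<n} = C - {0}"
proof
  have fin: "finite C" using cuts(1) by (rule finite_subset) simp
  show "(\<lambda>j. card {i. i < n \<and> linked i j}) ` {..<n} \<subseteq> C - {0}"
  proof clarify
    fix j assume j: "j < n"
    let ?s = "LEAST s. s \<in> C \<and> upper s j"
    have "upper n j"
      using nonzero_mat_entry[OF carrier[OF j] nonzero[OF j]] unfolding upper_def by blast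
    then have s: "?s \<in> C" "upper ?s j"
      using LeastI[of "\<lambda>s. s \<in> C \<and> upper s j" n] cuts by auto
    have "?s \<le> r" if "r \<in> C" "upper r j" for r
      using that by (simp add: Least_le)
    then have "linked i j \<longleftrightarrow> upper ?s i" if "i < n" for i
      unfolding linked_iff[OF that j] using s upper_mono by blast
    then have "{i. i < n \<and> linked i j} = {i. i < n \<and> upper ?s i}"
      by blast
    then have "card {i. i < n \<and> linked i j} = ?s"
      using card_upper s by simp
    moreover have "?s \<noteq> 0" using s(2) by (auto simp: upper_def)
    ultimately show "card {i. i < n \<and> linked i j} \<in> C - {0}" using s(1) by simp
  qed
  show "C - {0} \<subseteq> (\<lambda>j. card {i. i < n \<and> linked i j}) ` {..<n}"
  proof
    fix s assume s: "s \<in> C - {0}"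
    let ?D = "{t \<in> C. t < s}"
    \<comment> \<open>The cut just before \<open>s\<close>; it exists because \<open>0\<close> is a
      cut.\<close>
    define t where "t = Max ?D"
    have D: "finite ?D" "?D \<noteq> {}" using fin s cuts by auto
    have t: "t \<in> C" "t < s" using Max_in[OF D] by (auto simp: t_def)
    have max: "r \<le> t" if "r \<in> C" "r < s" for r
      using D that by (auto simp: t_def)
    have "\<not> {i. i < n \<and> upper s i} \<subseteq> {i. i < n \<and> upper t i}"
      using card_mono[of "{i. i < n \<and> upper t i}" "{i. i < n \<and> upper s i}"]
        card_upper[of s] card_upper[of t] s t by auto
    then obtain j where j: "j < n" "upper s j" "\<not> upper t j" by auto
    have "s \<le> r" if "r \<in> C" "upper r j" for r
      using max that j upper_mono by (meson not_le)
    then have "linked i j \<longleftrightarrow> upper s i" if "i < n" for i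
      unfolding linked_iff[OF that j(1)] using s j upper_mono by blast
    then have "{i. i < n \<and> linked i j} = {i. i < n \<and> upper s i}"
      by blast
    then have "card {i. i < n \<and> linked i j} = s" using card_upper s by auto
    then show "s \<in> (\<lambda>j. card {i. i < n \<and> linked i j}) ` {..<n}" using j by force
  qed
qed

section \<open>Peirce spaces and betweenness\<close>

lemma peirce_sandwich:
  assumes "i < n" "j < n" "i \<noteq> j" "x \<in> cut_algebra n C"
  shows "f i * x * f j \<in> peirce (cut_algebra n C) f i j"
proof -
  note c = carrier[OF assms(1)] carrier[OF assms(2)] cut_algebra_carrier[OF assms(4)]
  let ?z = "f i * x * f j"
  have z: "?z \<in> carrier_mat n n" using c by simp
  have "f i * ?z = (f i * f i) * x * f j" "f j * ?z = (f j * f i) * x * f j"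
    "?z * f i = f i * x * (f j * f i)" "?z * f j = f i * x * (f j * f j)"
    using c by (simp_all add: assoc_mult_mat[of _ n n _ n _ n])
  then have "f i * ?z = ?z" "f j * ?z = 0\<^sub>m n n" "?z * f i = 0\<^sub>m n n" "?z * f j = ?z"
    using c assms by (simp_all add: orth)
  moreover have "?z \<in> cut_algebra n C"
    using assms in_alg cuts(1) by (simp add: cut_algebra_mult)
  ultimately show ?thesis
    using z by (simp add: peirce_def jordan_prod_def)
qed

text \<open>Multiplying \<open>x = x * f i + f i * x\<close> by \<open>f j\<close> from the left or
  the right kills one summand, and the two results add up to \<open>x\<close> by the Jordan equation
  for \<open>f j\<close>.\<close>

lemma peirce_decomp:
  assumes "i < n" "j < n" "i \<noteq> j" "x \<in> peirce (cut_algebra n C) f i j"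
  shows "x = f i * x * f j + f j * x * f i"
proof -
  have x: "x \<in> carrier_mat n n" and xi: "x * f i + f i * x = x" and xj: "x * f j + f j * x = x"
    using assms(4) cut_algebra_carrier by (auto simp: peirce_def jordan_prod_def)
  note c = carrier[OF assms(1)] carrier[OF assms(2)] x
  have "f j * x = f j * (x * f i + f i * x)" using xi by simp
  also have "\<dots> = f j * x * f i + (f j * f i) * x"
    using c by (simp add: mult_add_distrib_mat[of _ n n _ n] assoc_mult_mat[of _ n n _ n _ n])
  also have "\<dots> = f j * x * f i" using c assms by (simp add: orth)
  finally have 1: "f j * x = f j * x * f i" .
  have "x * f j = (x * f i + f i * x) * f j" using xi by simp
  also have "\<dots> = x * (f i * f j) + f i * x * f j"
    using c by (simp add: add_mult_distrib_mat[of _ n n _ _ n] assoc_mult_mat[of _ n n _ n _ n])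
  also have "\<dots> = f i * x * f j" using c assms by (simp add: orth)
  finally have 2: "x * f j = f i * x * f j" .
  show ?thesis using xj 1 2 by simp
qed

lemma mult_orth:
  assumes "i < n" "j < n" "i \<noteq> j"
    and "x \<in> carrier_mat n n" "y \<in> carrier_mat n n" "z \<in> carrier_mat n n"
  shows "(x * f i) * (f j * y * z) = 0\<^sub>m n n"
proof -
  have "(x * f i) * (f j * y * z) = x * (f i * f j) * y * z"
    using carrier[OF assms(1)] carrier[OF assms(2)] assms(4-)
    by (simp add: assoc_mult_mat[of _ n n _ n _ n])
  then show ?thesis using assms by (simp add: orth)
qed

text \<open>Both arguments split into their two directed Peirce parts. Products of parts directed
  oppositely along the path \<open>i, j, k\<close> vanish by orthogonality; the others need both
  links in one direction.\<close>

lemma linked_if_jordan_prod_nonzero: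
  assumes ijk: "i < n" "j < n" "k < n" "i \<noteq> j" "j \<noteq> k"
    and x: "x \<in> peirce (cut_algebra n C) f i j" and y: "y \<in> peirce (cut_algebra n C) f j k"
    and nz: "jordan_prod x y \<noteq> 0\<^sub>m n n"
  shows "(linked i j \<and> linked j k) \<or> (linked k j \<and> linked j i)"
proof (rule ccontr)
  assume not: "\<not> ?thesis"
  have xA: "x \<in> cut_algebra n C" and yA: "y \<in> cut_algebra n C"
    using x y by (auto simp: peirce_def)
  note fxy = carrier[OF ijk(1)] carrier[OF ijk(2)] carrier[OF ijk(3)]
    cut_algebra_carrier[OF xA] cut_algebra_carrier[OF yA]
  define a b where ab: "a = f i * x * f j" "b = f j * x * f i"
  define c d where cd: "c = f j * y * f k" "d = f k * y * f j"
  have xy: "x = a + b" "y = c + d"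
    unfolding ab cd using peirce_decomp ijk x y by blast+
  have carr: "a \<in> carrier_mat n n" "b \<in> carrier_mat n n" "c \<in> carrier_mat n n" "d \<in> carrier_mat n n"
    unfolding ab cd using fxy by simp_all
  have "a * d = 0\<^sub>m n n" "d * a = 0\<^sub>m n n" "b * c = 0\<^sub>m n n" "c * b = 0\<^sub>m n n"
    unfolding ab cd using fxy ijk by - (rule mult_orth; simp)+
  moreover have "a = 0\<^sub>m n n" if "\<not> linked i j" using that xA by (auto simp: linked_def ab)
  moreover have "b = 0\<^sub>m n n" if "\<not> linked j i" using that xA by (auto simp: linked_def ab)
  moreover have "c = 0\<^sub>m n n" if "\<not> linked j k" using that yA by (auto simp: linked_def cd)
  moreover have "d = 0\<^sub>m n n" if "\<not> linked k j" using that yA by (auto simp: linked_def cd)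
  ultimately have "a = 0\<^sub>m n n \<or> c = 0\<^sub>m n n" "b = 0\<^sub>m n n \<or> d = 0\<^sub>m n n"
      and cross: "a * d = 0\<^sub>m n n" "d * a = 0\<^sub>m n n" "b * c = 0\<^sub>m n n" "c * b = 0\<^sub>m n n"
    using not by blast+
  \<comment> \<open>Orthogonality cannot dispose of \<open>c * a\<close> and \<open>b * d\<close>
    when \<open>i = k\<close>; these products vanish because one factor is zero.\<close>
  then have "a * c = 0\<^sub>m n n" "c * a = 0\<^sub>m n n" "b * d = 0\<^sub>m n n" "d * b = 0\<^sub>m n n"
    using carr by auto
  with cross have "(a + b) * (c + d) = 0\<^sub>m n n" "(c + d) * (a + b) = 0\<^sub>m n n"
    using carr by (simp_all add: mult_add_distrib_mat[of _ n n _ n] add_mult_distrib_mat[of _ n n _ _ n])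
  then have "x * y = 0\<^sub>m n n" "y * x = 0\<^sub>m n n"
    unfolding xy[symmetric] .
  then show False using nz by (simp add: jordan_prod_def)
qed

lemma jordan_prod_nonzero_if_linked:
  assumes ijk: "i < n" "j < n" "k < n" "i \<noteq> j" "j \<noteq> k" and link: "linked i j" "linked j k"
  shows "\<exists>x \<in> peirce (cut_algebra n C) f i j. \<exists>y \<in> peirce (cut_algebra n C) f j k.
    jordan_prod x y \<noteq> 0\<^sub>m n n"
proof -
  have "\<exists>p q. p < n \<and> q < n \<and> f l $$ (p, q) \<noteq> 0 \<and> (\<forall>s\<in>C. (p < s \<longleftrightarrow> upper s l) \<and> (q < s \<longleftrightarrow> upper s l))"
    if "l < n" for l
    using core_entry[OF that] by metis
  then obtain p q where pq: "\<And>l. l < n \<Longrightarrow> p l < n \<and> q l < n \<and> f l $$ (p l, q l) \<noteq> 0 \<and>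
      (\<forall>s\<in>C. (p l < s \<longleftrightarrow> upper s l) \<and> (q l < s \<longleftrightarrow> upper s l))"
    by metis
  \<comment> \<open>These units join a core entry of \<open>f i\<close> to one of
    \<open>f j\<close>, and a core entry of \<open>f j\<close> to one of \<open>f k\<close>. Linkage
    puts them into the algebra.\<close>
  define E F :: "complex mat" where "E = unit_mat n (q i) (p j)" and "F = unit_mat n (q j) (p k)"
  let ?x = "f i * E * f j" and ?y = "f j * F * f k"
  note c = carrier[OF ijk(1)] carrier[OF ijk(2)] carrier[OF ijk(3)]
  have "q l < s" if "linked l m" "l < n" "m < n" "s \<in> C" "p m < s" for l m s
    using that pq[of l] pq[of m] linked_iff[of l m] by blast
  then have EF: "E \<in> cut_algebra n C" "F \<in> cut_algebra n C"
    unfolding E_def F_def using link ijk by (blast intro: unit_mat_cut_algebra[OF cuts(1)])+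
  have x: "?x \<in> peirce (cut_algebra n C) f i j" and y: "?y \<in> peirce (cut_algebra n C) f j k"
    using peirce_sandwich ijk EF by blast+
  note c = c EF[THEN cut_algebra_carrier]
  have "?x * ?y = f i * E * (f j * f j) * F * f k"
    using c by (simp add: assoc_mult_mat[of _ n n _ n _ n])
  also have "\<dots> = ?x * F * f k"
    using ijk by (simp add: orth)
  finally have assoc: "?x * ?y = ?x * F * f k" .
  have lt: "p i < n" "q i < n" "p j < n" "q j < n" "p k < n" "q k < n"
      and nz: "f i $$ (p i, q i) \<noteq> 0" "f j $$ (p j, q j) \<noteq> 0" "f k $$ (p k, q k) \<noteq> 0"
    using pq ijk by blast+
  have "(?x * ?y) $$ (p i, q k) = ?x $$ (p i, q j) * f k $$ (p k, q k)"
    unfolding assoc unfolding F_def using c lt by (intro index_mult_unit_mat) auto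
  also have "?x $$ (p i, q j) = f i $$ (p i, q i) * f j $$ (p j, q j)"
    unfolding E_def using c lt by (intro index_mult_unit_mat) auto
  finally have "(?x * ?y) $$ (p i, q k) \<noteq> 0"
    using nz by simp
  then have xy: "?x * ?y \<noteq> 0\<^sub>m n n"
    using lt by (metis index_zero_mat(1))
  \<comment> \<open>For \<open>i = k\<close> the two summands of the Jordan product might cancel.
    Left multiplication by \<open>f i\<close> removes the second one, which starts with
    \<open>f j\<close>, and fixes the first.\<close>
  have "f i * jordan_prod ?x ?y = (f i * f i) * E * f j * ?y + (f i * f j) * F * f k * ?x"
    unfolding jordan_prod_def
    using c by (simp add: assoc_mult_mat[of _ n n _ n _ n] mult_add_distrib_mat[of _ n n _ n])
  also have "\<dots> = ?x * ?y"
    using c ijk by (simp add: orth mult_carrier_mat[of _ n n _ n] right_add_zero_mat[of _ n n])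
  finally have "jordan_prod ?x ?y \<noteq> 0\<^sub>m n n"
    using xy c by auto
  then show ?thesis using x y by blast
qed

text \<open>The second alternative is the first with \<open>i\<close> and \<open>k\<close>
  exchanged, and the Jordan product is commutative. The left side uses only notions that a Jordan
  isomorphism preserves, which makes betweenness an invariant.\<close>

lemma jordan_prod_nonzero_iff:
  assumes "i < n" "j < n" "k < n" "i \<noteq> j" "j \<noteq> k"
  shows "(\<exists>x \<in> peirce (cut_algebra n C) f i j. \<exists>y \<in> peirce (cut_algebra n C) f j k.
      jordan_prod x y \<noteq> 0\<^sub>m n n)
    \<longleftrightarrow> (linked i j \<and> linked j k) \<or> (linked k j \<and> linked j i)" (is "?lhs \<longleftrightarrow> ?rhs")
proof
  show ?rhs if ?lhs using that linked_if_jordan_prod_nonzero assms by blast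
  assume ?rhs
  then show ?lhs
  proof
    assume "linked k j \<and> linked j i"
    then obtain y x where *: "y \<in> peirce (cut_algebra n C) f k j" "x \<in> peirce (cut_algebra n C) f j i"
        "jordan_prod y x \<noteq> 0\<^sub>m n n"
      using jordan_prod_nonzero_if_linked[of k j i] assms by auto
    have "x \<in> carrier_mat n n" "y \<in> carrier_mat n n"
      using * cut_algebra_carrier by (auto simp: peirce_def)
    then have "jordan_prod x y = jordan_prod y x"
      unfolding jordan_prod_def by (intro comm_add_mat[of _ n n]) auto
    then show ?lhs using * by (auto simp: peirce_def)
  qed (use jordan_prod_nonzero_if_linked assms in blast)
qed

end

lemma idempotent_frame_unit_mat:
  assumes "C \<subseteq> {..n}" "0 \<in> C" "n \<in> C"
  shows "idempotent_frame n C (\<lambda>i. unit_mat n i i)"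
proof
  fix i j assume ij: "i < n" "j < n"
  show "unit_mat n i i \<in> cut_algebra n C"
    using assms by (intro unit_mat_cut_algebra) auto
  show "(unit_mat n i i :: complex mat) \<noteq> 0\<^sub>m n n"
  proof
    assume "(unit_mat n i i :: complex mat) = 0\<^sub>m n n"
    then have "unit_mat n i i $$ (i, i) = (0\<^sub>m n n $$ (i, i) :: complex)" by simp
    then show False using ij by (simp add: unit_mat_def)
  qed
  show "unit_mat n i i * unit_mat n j j = (if i = j then unit_mat n i i else 0\<^sub>m n n :: complex mat)"
  proof (rule eq_matI)
    fix a b assume "a < dim_row (if i = j then unit_mat n i i else 0\<^sub>m n n :: complex mat)"
      "b < dim_col (if i = j then unit_mat n i i else 0\<^sub>m n n :: complex mat)"
    then have ab: "a < n" "b < n" by (auto simp: unit_mat_def split: if_splits)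
    \<comment> \<open>The identity factor brings the product into the sandwich form of
      \<open>index_mult_unit_mat\<close>.\<close>
    have "(1\<^sub>m n * unit_mat n i i * unit_mat n j j) $$ (a, b)
        = 1\<^sub>m n $$ (a, i) * (unit_mat n j j $$ (i, b) :: complex)"
      using ab ij by (intro index_mult_unit_mat) auto
    then show "(unit_mat n i i * unit_mat n j j) $$ (a, b)
        = (if i = j then unit_mat n i i else 0\<^sub>m n n :: complex mat) $$ (a, b)"
      using ab ij left_mult_one_mat[OF unit_mat_carrier, of n i i] by (auto simp: unit_mat_def)
  qed (auto simp: unit_mat_def)
qed (use assms in auto)

section \<open>Transport of frames along isomorphisms\<close>

lemma linear_bij_zero:
  assumes "linear_bij (cut_algebra n C) (cut_algebra n D) \<phi>" "C \<subseteq> {..n}"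
  shows "\<phi> (0\<^sub>m n n) = 0\<^sub>m n n"
proof -
  have z: "0\<^sub>m n n \<in> cut_algebra n C" using assms(2) by (rule cut_algebra_zero)
  then have "\<phi> (0\<^sub>m n n) \<in> carrier_mat n n"
    using assms(1) by (auto simp: linear_bij_def intro: cut_algebra_carrier dest: bij_betwE)
  moreover have "\<phi> (0 \<cdot>\<^sub>m 0\<^sub>m n n) = 0 \<cdot>\<^sub>m \<phi> (0\<^sub>m n n)"
    using assms(1) z unfolding linear_bij_def by blast
  moreover have "0 \<cdot>\<^sub>m M = 0\<^sub>m n n" if "M \<in> carrier_mat n n" for M :: "complex mat"
    using that by (intro eq_matI) auto
  ultimately show ?thesis by simp
qed

lemma linear_bij_eq_iff:
  "linear_bij A B \<phi> \<Longrightarrow> x \<in> A \<Longrightarrow> y \<in> A \<Longrightarrow> \<phi> x = \<phi> y \<longleftrightarrow> x = y"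
  by (auto simp: linear_bij_def bij_betw_def inj_on_def)

lemma add_self_mat_eq:
  fixes A B :: "complex mat"
  assumes "A \<in> carrier_mat n n" "B \<in> carrier_mat n n" "A + A = B + B"
  shows "A = B"
proof (rule eq_matI)
  fix a b assume "a < dim_row B" "b < dim_col B"
  then have "A $$ (a, b) + A $$ (a, b) = B $$ (a, b) + B $$ (a, b)"
    using arg_cong[OF assms(3), of "\<lambda>M. M $$ (a, b)"] assms(1,2) by simp
  then show "A $$ (a, b) = B $$ (a, b)" by (simp add: complex_eq_iff)
qed (use assms in auto)

text \<open>Multiplying \<open>P * Q + Q * P = 0\<close> by \<open>P\<close> on either side shows
  that \<open>P * Q\<close> and \<open>Q * P\<close> both equal the negative of
  \<open>P * Q * P\<close>. They are therefore equal as well as opposite, hence zero.\<close>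

lemma idempotents_orthogonal_if_jordan_orthogonal:
  fixes P Q :: "complex mat"
  assumes P: "P \<in> carrier_mat n n" and Q: "Q \<in> carrier_mat n n"
    and idem: "P * P = P" and orth: "jordan_prod P Q = 0\<^sub>m n n"
  shows "P * Q = 0\<^sub>m n n"
proof -
  have 0: "P * Q + Q * P = 0\<^sub>m n n" using orth by (simp add: jordan_prod_def)
  have "P * (P * Q + Q * P) = (P * P) * Q + P * Q * P"
    using P Q by (simp add: assoc_mult_mat[of _ n n _ n _ n] mult_add_distrib_mat[of _ n n _ n])
  then have 1: "P * Q + P * Q * P = 0\<^sub>m n n" using 0 P idem by simp
  have "(P * Q + Q * P) * P = P * Q * P + Q * (P * P)"
    using P Q by (simp add: assoc_mult_mat[of _ n n _ n _ n] add_mult_distrib_mat[of _ n n _ _ n])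
  then have 2: "P * Q * P + Q * P = 0\<^sub>m n n" using 0 P idem by simp
  have "(P * Q) $$ (a, b) = 0" if ab: "a < n" "b < n" for a b
  proof -
    have c: "P * Q \<in> carrier_mat n n" "Q * P \<in> carrier_mat n n" "P * Q * P \<in> carrier_mat n n"
      using P Q by simp_all
    have "(P * Q) $$ (a, b) + (Q * P) $$ (a, b) = 0"
      using arg_cong[OF 0, of "\<lambda>M. M $$ (a, b)"] c ab P Q by (simp del: index_mult_mat(1))
    moreover have "(P * Q) $$ (a, b) + (P * Q * P) $$ (a, b) = 0"
      using arg_cong[OF 1, of "\<lambda>M. M $$ (a, b)"] c ab P Q by (simp del: index_mult_mat(1))
    moreover have "(P * Q * P) $$ (a, b) + (Q * P) $$ (a, b) = 0"
      using arg_cong[OF 2, of "\<lambda>M. M $$ (a, b)"] c ab P Q by (simp del: index_mult_mat(1))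
    ultimately show ?thesis unfolding complex_eq_iff plus_complex.sel zero_complex.sel by linarith
  qed
  then show ?thesis using P Q by (intro eq_matI) (auto simp del: index_mult_mat(1))
qed

text \<open>Isomorphisms and antiisomorphisms preserve the Jordan product too, so all three cases
  are treated in this setting and differ only in how the linkage of the image frame compares with
  the original one.\<close>

locale jordan_iso = idempotent_frame n C f for n C f +
  fixes D :: "nat set" and \<phi> :: "complex mat \<Rightarrow> complex mat"
  assumes target_cuts: "D \<subseteq> {..n}" "0 \<in> D" "n \<in> D"
    and lin: "linear_bij (cut_algebra n C) (cut_algebra n D) \<phi>"
    and jordan: "\<And>X Y. X \<in> cut_algebra n C \<Longrightarrow> Y \<in> cut_algebra n C \<Longrightarrow>
      \<phi> (jordan_prod X Y) = jordan_prod (\<phi> X) (\<phi> Y)"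
begin

lemma image: "\<phi> ` cut_algebra n C = cut_algebra n D"
  using lin by (simp add: linear_bij_def bij_betw_def)

lemma zero_iff: "x \<in> cut_algebra n C \<Longrightarrow> \<phi> x = 0\<^sub>m n n \<longleftrightarrow> x = 0\<^sub>m n n"
  using linear_bij_eq_iff[OF lin _ cut_algebra_zero[OF cuts(1)]] linear_bij_zero[OF lin cuts(1)] by simp

text \<open>Squares are visible to the Jordan product up to a factor 2, which is cancelled, and
  idempotents with zero Jordan product are orthogonal.\<close>

lemma image_frame: "idempotent_frame n D (\<lambda>i. \<phi> (f i))"
proof
  fix i assume i: "i < n"
  note A = in_alg[OF i]
  show B: "\<phi> (f i) \<in> cut_algebra n D" using image A by blast
  note c = cut_algebra_carrier[OF B]
  show "\<phi> (f i) \<noteq> 0\<^sub>m n n" using zero_iff[OF A] nonzero[OF i] by simp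
  have "\<phi> (f i) * \<phi> (f i) + \<phi> (f i) * \<phi> (f i) = \<phi> (f i + f i)"
    using jordan[OF A A] orth[OF i i] by (simp add: jordan_prod_def)
  also have "\<dots> = \<phi> (f i) + \<phi> (f i)"
    using lin A by (simp add: linear_bij_def)
  finally have idem: "\<phi> (f i) * \<phi> (f i) = \<phi> (f i)"
    using add_self_mat_eq c by (metis mult_carrier_mat)
  fix j assume j: "j < n"
  note A' = in_alg[OF j]
  have B': "\<phi> (f j) \<in> cut_algebra n D" using image A' by blast
  have "\<phi> (f i) * \<phi> (f j) = 0\<^sub>m n n" if "i \<noteq> j"
  proof (rule idempotents_orthogonal_if_jordan_orthogonal[OF c cut_algebra_carrier[OF B'] idem])
    have "jordan_prod (f i) (f j) = 0\<^sub>m n n"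
      using that orth i j by (simp add: jordan_prod_def)
    then show "jordan_prod (\<phi> (f i)) (\<phi> (f j)) = 0\<^sub>m n n"
      using jordan[OF A A'] linear_bij_zero[OF lin cuts(1)] by simp
  qed
  then show "\<phi> (f i) * \<phi> (f j) = (if i = j then \<phi> (f i) else 0\<^sub>m n n)"
    using idem by (cases "i = j") auto
qed (use target_cuts in auto)

sublocale target: idempotent_frame n D "\<lambda>i. \<phi> (f i)"
  by (rule image_frame)

lemma linked_if_mult:
  assumes mult: "\<And>X Y. X \<in> cut_algebra n C \<Longrightarrow> Y \<in> cut_algebra n C \<Longrightarrow> \<phi> (X * Y) = \<phi> X * \<phi> Y"
    and ij: "i < n" "j < n"
  shows "target.linked i j \<longleftrightarrow> linked i j"
proof -
  have "\<phi> (f i) * \<phi> x * \<phi> (f j) = 0\<^sub>m n n \<longleftrightarrow> f i * x * f j = 0\<^sub>m n n" if "x \<in> cut_algebra n C" for x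
    using that ij mult zero_iff in_alg cut_algebra_mult[OF cuts(1)] by metis
  then show ?thesis
    unfolding linked_def target.linked_def image[symmetric] by auto
qed

lemma linked_if_antimult:
  assumes antimult: "\<And>X Y. X \<in> cut_algebra n C \<Longrightarrow> Y \<in> cut_algebra n C \<Longrightarrow> \<phi> (X * Y) = \<phi> Y * \<phi> X"
    and ij: "i < n" "j < n"
  shows "target.linked i j \<longleftrightarrow> linked j i"
proof -
  have "\<phi> (f i) * \<phi> x * \<phi> (f j) = 0\<^sub>m n n \<longleftrightarrow> f j * x * f i = 0\<^sub>m n n" if x: "x \<in> cut_algebra n C" for x
  proof -
    have "\<phi> x \<in> carrier_mat n n" using image x cut_algebra_carrier by blast
    then have "\<phi> (f i) * \<phi> x * \<phi> (f j) = \<phi> (f i) * (\<phi> x * \<phi> (f j))"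
      using target.carrier[OF ij(1)] target.carrier[OF ij(2)] by (intro assoc_mult_mat)
    also have "\<dots> = \<phi> (f j * x * f i)"
      using x ij antimult in_alg cut_algebra_mult[OF cuts(1)] by metis
    finally show ?thesis
      using x ij zero_iff in_alg cut_algebra_mult[OF cuts(1)] by metis
  qed
  then show ?thesis
    unfolding linked_def target.linked_def image[symmetric] by auto
qed

lemma image_peirce:
  assumes "i < n" "j < n"
  shows "\<phi> ` peirce (cut_algebra n C) f i j = peirce (cut_algebra n D) (\<lambda>i. \<phi> (f i)) i j"
proof -
  have "jordan_prod (\<phi> x) (\<phi> (f l)) = \<phi> x \<longleftrightarrow> jordan_prod x (f l) = x"
    if "x \<in> cut_algebra n C" "l < n" for x l
    using that jordan[of x "f l"] in_alg linear_bij_eq_iff[OF lin] cut_algebra_jordan_prod[OF cuts(1)]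
    by metis
  then show ?thesis
    using assms unfolding peirce_def image[symmetric] by blast
qed

lemma betweenness:
  assumes "i < n" "j < n" "k < n" "i \<noteq> j" "j \<noteq> k"
  shows "(target.linked i j \<and> target.linked j k) \<or> (target.linked k j \<and> target.linked j i)
    \<longleftrightarrow> (linked i j \<and> linked j k) \<or> (linked k j \<and> linked j i)"
proof -
  have "jordan_prod (\<phi> x) (\<phi> y) = 0\<^sub>m n n \<longleftrightarrow> jordan_prod x y = 0\<^sub>m n n"
    if "x \<in> peirce (cut_algebra n C) f i j" "y \<in> peirce (cut_algebra n C) f j k" for x y
    using that zero_iff jordan cut_algebra_jordan_prod[OF cuts(1)] unfolding peirce_def
    by (metis (no_types, lifting) mem_Collect_eq)
  then show ?thesis
    unfolding jordan_prod_nonzero_iff[OF assms, symmetric] target.jordan_prod_nonzero_iff[OF assms, symmetric]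
      image_peirce[OF assms(1,2), symmetric] image_peirce[OF assms(2,3), symmetric]
    by auto
qed

end

section \<open>Total preorders with the same betweenness relation\<close>

text \<open>On each pair \<open>S\<close> agrees with \<open>R\<close> (\<open>same\<close>) or with
  its reverse (\<open>flip\<close>), and both happen exactly for equivalent elements. One
  inequivalent pair of type \<open>same\<close> forces this type on all pairs that share an element
  with it, and from there on all pairs.\<close>

lemma betweenness_determines_preorder:
  fixes R S :: "'a \<Rightarrow> 'a \<Rightarrow> bool"
  assumes R: "\<And>i j. i \<in> N \<Longrightarrow> j \<in> N \<Longrightarrow> R i j \<or> R j i"
      "\<And>i j k. i \<in> N \<Longrightarrow> j \<in> N \<Longrightarrow> k \<in> N \<Longrightarrow> R i j \<Longrightarrow> R j k \<Longrightarrow> R i k"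
    and S: "\<And>i j. i \<in> N \<Longrightarrow> j \<in> N \<Longrightarrow> S i j \<or> S j i"
      "\<And>i j k. i \<in> N \<Longrightarrow> j \<in> N \<Longrightarrow> k \<in> N \<Longrightarrow> S i j \<Longrightarrow> S j k \<Longrightarrow> S i k"
    and btw: "\<And>i j k. i \<in> N \<Longrightarrow> j \<in> N \<Longrightarrow> k \<in> N \<Longrightarrow> i \<noteq> j \<Longrightarrow> j \<noteq> k \<Longrightarrow>
      (S i j \<and> S j k) \<or> (S k j \<and> S j i) \<longleftrightarrow> (R i j \<and> R j k) \<or> (R k j \<and> R j i)"
  shows "(\<forall>i\<in>N. \<forall>j\<in>N. S i j \<longleftrightarrow> R i j) \<or> (\<forall>i\<in>N. \<forall>j\<in>N. S i j \<longleftrightarrow> R j i)"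
proof -
  \<comment> \<open>For \<open>i = j\<close> or \<open>j = k\<close> both sides hold by
    totality.\<close>
  have btw': "(S i j \<and> S j k) \<or> (S k j \<and> S j i) \<longleftrightarrow> (R i j \<and> R j k) \<or> (R k j \<and> R j i)"
    if "i \<in> N" "j \<in> N" "k \<in> N" for i j k
    using btw[OF that] R(1) S(1) that by blast
  \<comment> \<open>Betweenness with equal outer elements is equivalence.\<close>
  have equiv: "S i j \<and> S j i \<longleftrightarrow> R i j \<and> R j i" if "i \<in> N" "j \<in> N" for i j
    using btw'[of i j i] that by blast
  define same where "same i j \<longleftrightarrow> (S i j \<longleftrightarrow> R i j) \<and> (S j i \<longleftrightarrow> R j i)" for i j
  define flip where "flip i j \<longleftrightarrow> (S i j \<longleftrightarrow> R j i) \<and> (S j i \<longleftrightarrow> R i j)" for i j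
  have dich: "same i j \<or> flip i j" if "i \<in> N" "j \<in> N" for i j
    using equiv R(1) S(1) that unfolding same_def flip_def by blast
  have sym: "same i j \<longleftrightarrow> same j i" "flip i j \<longleftrightarrow> flip j i" for i j
    unfolding same_def flip_def by blast+
  \<comment> \<open>A propositional check on three elements: betweenness for each choice of middle
    element, totality, and transitivity.\<close>
  have adj: "same i k" if N: "i \<in> N" "j \<in> N" "k \<in> N" and ij: "same i j" "\<not> flip i j" for i j k
  proof (rule ccontr)
    assume "\<not> same i k"
    then show False
      using btw'[OF N(1,2,3)] btw'[OF N(2,3,1)] btw'[OF N(3,1,2)] ij
        R(1)[OF N(1,2)] R(1)[OF N(2,3)] R(1)[OF N(1,3)] S(1)[OF N(1,2)] S(1)[OF N(2,3)] S(1)[OF N(1,3)]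
        R(2)[OF N(1,2,3)] R(2)[OF N(1,3,2)] R(2)[OF N(2,1,3)]
        R(2)[OF N(2,3,1)] R(2)[OF N(3,1,2)] R(2)[OF N(3,2,1)]
        S(2)[OF N(1,2,3)] S(2)[OF N(1,3,2)] S(2)[OF N(2,1,3)]
        S(2)[OF N(2,3,1)] S(2)[OF N(3,1,2)] S(2)[OF N(3,2,1)]
      unfolding same_def flip_def by argo
  qed
  have "(\<forall>i\<in>N. \<forall>j\<in>N. same i j) \<or> (\<forall>i\<in>N. \<forall>j\<in>N. flip i j)"
  proof (rule disjCI)
    assume "\<not> (\<forall>i\<in>N. \<forall>j\<in>N. flip i j)"
    then obtain i j where ij: "i \<in> N" "j \<in> N" "same i j" "\<not> flip i j"
      using dich by blast
    show "\<forall>k\<in>N. \<forall>l\<in>N. same k l"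
    proof (intro ballI)
      fix k l assume kl: "k \<in> N" "l \<in> N"
      have i: "same i m" if "m \<in> N" for m using adj[of i j m] ij that by blast
      have j: "same j m" if "m \<in> N" for m using adj[of j i m] ij that sym by blast
      \<comment> \<open>If \<open>k\<close> were also of type \<open>flip\<close> with both
        \<open>i\<close> and \<open>j\<close>, it would be equivalent to both, making
        \<open>i\<close> and \<open>j\<close> equivalent. So \<open>k\<close> forms an inequivalent
        pair of type \<open>same\<close> with one of them, and \<open>adj\<close> applies at
        \<open>k\<close>.\<close>
      show "same k l"
      proof (cases "flip k i")
        case False
        then show ?thesis using adj[of k i l] i kl ij sym by blast
      next
        case True
        have "\<not> flip k j"
        proof
          assume "flip k j"
          then show False
            using True i[OF kl(1)] j[OF kl(1)] ij(3,4) equiv[OF ij(1,2)] R(1)[OF ij(1,2)]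
              R(2)[OF ij(1) kl(1) ij(2)] R(2)[OF ij(2) kl(1) ij(1)]
              S(2)[OF ij(1) kl(1) ij(2)] S(2)[OF ij(2) kl(1) ij(1)]
              R(1)[OF ij(1) kl(1)] R(1)[OF ij(2) kl(1)]
            unfolding same_def flip_def by argo
        qed
        then show ?thesis using adj[of k j l] j kl ij sym by blast
      qed
    qed
  qed
  then show ?thesis unfolding same_def flip_def by blast
qed

section \<open>Reflection in the antidiagonal\<close>

text \<open>Unlike the ordinary transpose, this antiautomorphism keeps zeros below the diagonal
  there: it sends the region below the cut \<open>s\<close> to the one below
  \<open>n - s\<close>.\<close>

definition anti_transpose :: "nat \<Rightarrow> 'a mat \<Rightarrow> 'a mat" where
  "anti_transpose n X = mat n n (\<lambda>(a, b). X $$ (n - 1 - b, n - 1 - a))"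

lemma anti_transpose_carrier [simp]: "anti_transpose n X \<in> carrier_mat n n"
  by (simp add: anti_transpose_def)

lemma anti_transpose_twice: "X \<in> carrier_mat n n \<Longrightarrow> anti_transpose n (anti_transpose n X) = X"
  by (intro eq_matI) (auto simp: anti_transpose_def)

lemma anti_transpose_mult:
  fixes X Y :: "'a :: comm_semiring_0 mat"
  assumes X: "X \<in> carrier_mat n n" and Y: "Y \<in> carrier_mat n n"
  shows "anti_transpose n (X * Y) = anti_transpose n Y * anti_transpose n X"
proof (rule eq_matI)
  fix a b
  assume "a < dim_row (anti_transpose n Y * anti_transpose n X)"
    "b < dim_col (anti_transpose n Y * anti_transpose n X)"
  then have ab: "a < n" "b < n" by (simp_all add: anti_transpose_def)
  have "anti_transpose n (X * Y) $$ (a, b) = (X * Y) $$ (n - 1 - b, n - 1 - a)"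
    using ab by (simp add: anti_transpose_def)
  also have "\<dots> = (\<Sum>c<n. X $$ (n - 1 - b, c) * Y $$ (c, n - 1 - a))"
    using ab by (intro index_mult_mat_sum[OF X Y]) auto
  also have "\<dots> = (\<Sum>c<n. X $$ (n - 1 - b, n - 1 - c) * Y $$ (n - 1 - c, n - 1 - a))"
    by (rule sum.reindex_bij_witness[of _ "\<lambda>c. n - 1 - c" "\<lambda>c. n - 1 - c"]) auto
  also have "\<dots> = (\<Sum>c<n. anti_transpose n Y $$ (a, c) * anti_transpose n X $$ (c, b))"
    using ab by (intro sum.cong) (auto simp: anti_transpose_def mult.commute)
  also have "\<dots> = (anti_transpose n Y * anti_transpose n X) $$ (a, b)"
    using ab by (intro index_mult_mat_sum[symmetric]) auto
  finally show "anti_transpose n (X * Y) $$ (a, b) = (anti_transpose n Y * anti_transpose n X) $$ (a, b)" .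
qed (simp_all add: anti_transpose_def)

lemma anti_transpose_cut_algebra:
  assumes "C \<subseteq> {..n}" "X \<in> cut_algebra n C"
  shows "anti_transpose n X \<in> cut_algebra n ((-) n ` C)"
proof -
  have "anti_transpose n X $$ (a, b) = 0" if "s \<in> C" "b < n - s" "n - s \<le> a" "a < n" for s a b
  proof -
    have "n - 1 - a < s" "s \<le> n - 1 - b" "n - 1 - b < n" using that by auto
    then have "X $$ (n - 1 - b, n - 1 - a) = 0"
      using assms(2) that(1) unfolding cut_algebra_def by blast
    then show ?thesis using that by (simp add: anti_transpose_def)
  qed
  then show ?thesis by (auto simp: cut_algebra_def)
qed

lemma linear_bij_anti_transpose:
  assumes "C \<subseteq> {..n}"
  shows "linear_bij (cut_algebra n C) (cut_algebra n ((-) n ` C)) (anti_transpose n)"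
  unfolding linear_bij_def
proof (intro conjI ballI allI)
  have C': "(-) n ` C \<subseteq> {..n}" by auto
  \<comment> \<open>Truncated subtraction is an involution here because every cut is at most
    \<open>n\<close>.\<close>
  have "(-) n ` (-) n ` C = C"
    using assms by (force simp: image_image)
  then have inv: "anti_transpose n Y \<in> cut_algebra n C" if "Y \<in> cut_algebra n ((-) n ` C)" for Y
    using anti_transpose_cut_algebra[OF C' that] by simp
  show "bij_betw (anti_transpose n) (cut_algebra n C) (cut_algebra n ((-) n ` C))"
    by (rule bij_betw_byWitness[where f' = "anti_transpose n"])
      (use inv anti_transpose_cut_algebra[OF assms] anti_transpose_twice cut_algebra_carrier in blast)+
  show "anti_transpose n (X + Y) = anti_transpose n X + anti_transpose n Y"
    if "X \<in> cut_algebra n C" "Y \<in> cut_algebra n C" for X Y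
    using that[THEN cut_algebra_carrier] by (intro eq_matI) (auto simp: anti_transpose_def)
  show "anti_transpose n (c \<cdot>\<^sub>m X) = c \<cdot>\<^sub>m anti_transpose n X" if "X \<in> cut_algebra n C" for c X
    using that[THEN cut_algebra_carrier] by (intro eq_matI) (auto simp: anti_transpose_def)
qed

text \<open>By \<open>card_linked\<close> the preorder alone determines the nonzero cuts, whatever
  frame realizes it.\<close>

lemma cuts_eq_if_linked_eq:
  assumes "idempotent_frame n C f" "idempotent_frame n D g"
    and "\<And>i j. i < n \<Longrightarrow> j < n \<Longrightarrow>
      idempotent_frame.linked n C f i j \<longleftrightarrow> idempotent_frame.linked n D g i j"
  shows "C = D"
proof -
  have "C - {0} = D - {0}"
    unfolding idempotent_frame.card_linked[OF assms(1), symmetric]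
      idempotent_frame.card_linked[OF assms(2), symmetric]
    using assms(3) by (intro image_cong refl arg_cong[where f = card]) auto
  moreover have "0 \<in> C" "0 \<in> D"
    using assms(1,2) by (auto simp: idempotent_frame_def)
  ultimately show ?thesis by blast
qed

text \<open>Applying \<open>anti_transpose\<close> to the second frame reverses its linkage and
  reflects its cuts, which reduces the claim to equal linkages.\<close>

lemma cuts_reflected_if_linked_reversed:
  assumes "idempotent_frame n C f" "idempotent_frame n D g"
    and "\<And>i j. i < n \<Longrightarrow> j < n \<Longrightarrow>
      idempotent_frame.linked n C f i j \<longleftrightarrow> idempotent_frame.linked n D g j i"
  shows "C = (-) n ` D"
proof -
  interpret D: idempotent_frame n D g by fact
  have anti: "anti_transpose n (X * Y) = anti_transpose n Y * anti_transpose n X"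
    if "X \<in> cut_algebra n D" "Y \<in> cut_algebra n D" for X Y
    using that cut_algebra_carrier anti_transpose_mult by blast
  interpret T: jordan_iso n D g "(-) n ` D" "anti_transpose n"
  proof
    show "linear_bij (cut_algebra n D) (cut_algebra n ((-) n ` D)) (anti_transpose n)"
      using D.cuts(1) by (rule linear_bij_anti_transpose)
    then show "anti_transpose n (jordan_prod X Y) = jordan_prod (anti_transpose n X) (anti_transpose n Y)"
      if "X \<in> cut_algebra n D" "Y \<in> cut_algebra n D" for X Y
      using that anti D.cuts(1) comm_add_mat[of "anti_transpose n X * anti_transpose n Y" n n]
      by (simp add: jordan_prod_def linear_bij_def cut_algebra_mult mult_carrier_mat[of _ n n _ n])
  qed (use D.cuts in \<open>auto intro: rev_image_eqI\<close>)
  show ?thesis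
    using cuts_eq_if_linked_eq[OF assms(1) T.image_frame] assms(3) T.linked_if_antimult[OF anti] by blast
qed

section \<open>Block sizes and cuts\<close>

definition cuts :: "nat list \<Rightarrow> nat set" where
  "cuts ks = block_offset ks ` {..length ks}"

lemma block_offset_Cons [simp]: "block_offset (k # ks) (Suc i) = k + block_offset ks i"
  and block_offset_0 [simp]: "block_offset ks 0 = 0"
  and block_offset_length: "block_offset ks (length ks) = sum_list ks"
  by (simp_all add: block_offset_def)

lemma block_offset_Suc: "i < length ks \<Longrightarrow> block_offset ks (Suc i) = block_offset ks i + ks ! i"
  by (simp add: block_offset_def take_Suc_conv_app_nth)

lemma block_offset_mono: "i \<le> j \<Longrightarrow> block_offset ks i \<le> block_offset ks j"
proof -
  assume "i \<le> j"
  then have "take j ks = take i ks @ take (j - i) (drop i ks)"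
    by (metis le_add_diff_inverse take_add)
  then show ?thesis by (simp add: block_offset_def)
qed

lemma cuts_Nil: "cuts [] = {0}"
  by (simp add: cuts_def)

lemma cuts_Cons: "cuts (k # ks) = insert 0 ((+) k ` cuts ks)"
  by (simp add: cuts_def atMost_Suc_eq_insert_0 image_image)

lemma cuts_bounds: "cuts ks \<subseteq> {..sum_list ks}" "0 \<in> cuts ks" "sum_list ks \<in> cuts ks"
proof -
  show "cuts ks \<subseteq> {..sum_list ks}"
    using block_offset_mono by (auto simp: cuts_def block_offset_length[symmetric])
  show "0 \<in> cuts ks" unfolding cuts_def by (rule rev_image_eqI[of 0]) auto
  show "sum_list ks \<in> cuts ks"
    unfolding cuts_def by (rule rev_image_eqI[of "length ks"]) (auto simp: block_offset_length)
qed

text \<open>For positive sizes, the first block size is the least nonzero cut. Removing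
  \<open>0\<close> and shifting back by that size leaves the cuts of the tail.\<close>

lemma cuts_inject:
  assumes "\<forall>k\<in>set ks. 0 < k" "\<forall>l\<in>set ls. 0 < l" "cuts ks = cuts ls"
  shows "ks = ls"
  using assms
proof (induction ks arbitrary: ls)
  case Nil
  show ?case
  proof (cases ls)
    case (Cons l ls')
    have "l \<in> cuts ls" unfolding Cons cuts_Cons using cuts_bounds(2)[of ls'] by force
    then have "l = 0" using Nil(3) unfolding cuts_Nil by blast
    then show ?thesis using Nil(2) Cons by simp
  qed simp
next
  case (Cons k ks)
  obtain l ls' where ls: "ls = l # ls'"
  proof (cases ls)
    case Nil
    have "k \<in> cuts (k # ks)" unfolding cuts_Cons using cuts_bounds(2)[of ks] by force
    then have "k = 0" using Cons.prems(3) unfolding Nil cuts_Nil by blast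
    then show ?thesis using Cons.prems(1) by simp
  qed simp
  have pos: "0 < k" "0 < l" using Cons.prems ls by auto
  have eq: "(+) k ` cuts ks = (+) l ` cuts ls'"
  proof -
    have "0 \<notin> (+) k ` cuts ks" "0 \<notin> (+) l ` cuts ls'" using pos by auto
    then show ?thesis
      using Cons.prems(3) unfolding ls cuts_Cons by (simp add: insert_ident)
  qed
  have "k \<in> (+) k ` cuts ks" "l \<in> (+) l ` cuts ls'"
    using cuts_bounds(2) by force+
  then have "k \<in> (+) l ` cuts ls'" "l \<in> (+) k ` cuts ks"
    by (simp_all only: eq)
  then have "l \<le> k" "k \<le> l" by auto
  then have "k = l" by simp
  have "inj ((+) l)" by simp
  then have "cuts ks = cuts ls'"
    using eq unfolding \<open>k = l\<close> by (simp only: inj_image_eq_iff)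
  then have "ks = ls'"
    using Cons.prems(1,2) unfolding ls by (intro Cons.IH) simp_all
  then show ?case using ls \<open>k = l\<close> by simp
qed

text \<open>The first \<open>i\<close> blocks of the reversed list are the last \<open>i\<close>
  blocks of the original one, so each offset is the total minus an offset.\<close>

lemma cuts_rev: "cuts (rev ks) = (-) (sum_list ks) ` cuts ks"
proof -
  have *: "block_offset (rev ks) i = sum_list ks - block_offset ks (length ks - i)" for i
  proof -
    have "sum_list ks = sum_list (take (length ks - i) ks) + sum_list (drop (length ks - i) ks)"
      using sum_list.append[of "take (length ks - i) ks" "drop (length ks - i) ks"] by simp
    then show ?thesis by (simp add: block_offset_def take_rev)
  qed
  have "(-) (length ks) ` {..length ks} = {..length ks}"
  proof (intro equalityI subsetI)
    fix i assume "i \<in> {..length ks}"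
    then show "i \<in> (-) (length ks) ` {..length ks}"
      by (intro rev_image_eqI[of "length ks - i"]) auto
  qed auto
  then have "cuts ks = block_offset ks ` (-) (length ks) ` {..length ks}"
    by (simp only: cuts_def)
  moreover have "cuts (rev ks) = (\<lambda>i. sum_list ks - block_offset ks (length ks - i)) ` {..length ks}"
    unfolding cuts_def length_rev using * by (rule image_cong[OF refl])
  ultimately show ?thesis by (simp only: image_image)
qed

lemma block_of_index: "a < sum_list ks \<Longrightarrow> \<exists>i<length ks. block_offset ks i \<le> a \<and> a < block_offset ks (Suc i)"
proof (induction ks arbitrary: a)
  case (Cons k ks)
  show ?case
  proof (cases "a < k")
    case True
    then show ?thesis by (intro exI[of _ 0]) simp
  next
    case False
    have "a - k < sum_list ks" using False Cons.prems by auto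
    then obtain i where "i < length ks" "block_offset ks i \<le> a - k" "a - k < block_offset ks (Suc i)"
      using Cons.IH by blast
    then show ?thesis using False by (intro exI[of _ "Suc i"]) auto
  qed
qed simp

text \<open>An entry below the cut at offset \<open>m\<close> lies in a block \<open>(i, j)\<close>
  with \<open>j < m \<le> i\<close>. Conversely, a block with \<open>j < i\<close> lies below the
  cut where block row \<open>i\<close> starts.\<close>

lemma block_upper_triangular_eq_cut_algebra:
  "block_upper_triangular ks = cut_algebra (sum_list ks) (cuts ks)"
proof (intro equalityI subsetI)
  fix X assume X: "X \<in> block_upper_triangular ks"
  have "X $$ (a, b) = 0" if m: "m \<le> length ks" and ab: "b < block_offset ks m" "block_offset ks m \<le> a"
    "a < sum_list ks" for m a b
  proof -
    obtain i where i: "i < length ks" "block_offset ks i \<le> a" "a < block_offset ks (Suc i)"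
      using block_of_index ab by blast
    obtain j where j: "j < length ks" "block_offset ks j \<le> b" "b < block_offset ks (Suc j)"
      using block_of_index[of b ks] ab by auto
    have "m < Suc i" "j < m"
      using block_offset_mono[of "Suc i" m ks] block_offset_mono[of m j ks] i j ab by linarith+
    then have "block ks X i j = 0\<^sub>m (ks ! i) (ks ! j)"
      using X i by (simp add: block_upper_triangular_def)
    then have "block ks X i j $$ (a - block_offset ks i, b - block_offset ks j)
        = 0\<^sub>m (ks ! i) (ks ! j) $$ (a - block_offset ks i, b - block_offset ks j)"
      by simp
    moreover have "a - block_offset ks i < ks ! i" "b - block_offset ks j < ks ! j"
      using i j by (simp_all add: block_offset_Suc)
    ultimately show ?thesis
      using i j by (simp add: block_def)
  qed
  then show "X \<in> cut_algebra (sum_list ks) (cuts ks)"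
    using X by (auto simp: cut_algebra_def block_upper_triangular_def cuts_def)
next
  fix X assume X: "X \<in> cut_algebra (sum_list ks) (cuts ks)"
  have "block ks X i j = 0\<^sub>m (ks ! i) (ks ! j)" if ij: "i < length ks" "j < i" for i j
  proof (rule eq_matI)
    fix a b assume "a < dim_row (0\<^sub>m (ks ! i) (ks ! j) :: complex mat)"
      "b < dim_col (0\<^sub>m (ks ! i) (ks ! j) :: complex mat)"
    then have ab: "a < ks ! i" "b < ks ! j" by simp_all
    have "block_offset ks j + b < block_offset ks (Suc j)" "block_offset ks (Suc j) \<le> block_offset ks i"
      using ab ij block_offset_Suc[of j ks] block_offset_mono[of "Suc j" i ks] by auto
    moreover have "block_offset ks i + a < sum_list ks"
      using ab ij block_offset_Suc[of i ks] block_offset_mono[of "Suc i" "length ks" ks]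
      by (simp add: block_offset_length)
    moreover have "block_offset ks i \<in> cuts ks" using ij by (auto simp: cuts_def)
    ultimately have "X $$ (block_offset ks i + a, block_offset ks j + b) = 0"
      using X unfolding cut_algebra_def by (auto dest!: bspec)
    then show "block ks X i j $$ (a, b) = 0\<^sub>m (ks ! i) (ks ! j) $$ (a, b)"
      using ab by (simp add: block_def)
  qed (simp_all add: block_def)
  then show "X \<in> block_upper_triangular ks"
    using X by (simp add: cut_algebra_def block_upper_triangular_def)
qed

section \<open>From isomorphisms to block sizes\<close>

lemma jordan_iso_unit_frame:
  assumes "sum_list ks = n" "sum_list ls = n"
    and "linear_bij (block_upper_triangular ks) (block_upper_triangular ls) \<phi>"
    and "\<And>X Y. X \<in> block_upper_triangular ks \<Longrightarrow> Y \<in> block_upper_triangular ks \<Longrightarrow>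
      \<phi> (jordan_prod X Y) = jordan_prod (\<phi> X) (\<phi> Y)"
  shows "jordan_iso n (cuts ks) (\<lambda>i. unit_mat n i i) (cuts ls) \<phi>"
proof -
  interpret idempotent_frame n "cuts ks" "\<lambda>i. unit_mat n i i"
    using cuts_bounds[of ks] assms(1) by (intro idempotent_frame_unit_mat) auto
  show ?thesis
    by unfold_locales (use assms cuts_bounds[of ls] in \<open>auto simp: block_upper_triangular_eq_cut_algebra\<close>)
qed

text \<open>An antihomomorphism merely exchanges the two summands of the Jordan product.\<close>

lemma hom_or_antihom_preserves_jordan_prod:
  assumes "linear_bij (block_upper_triangular ks) (block_upper_triangular ls) \<phi>"
    and "X \<in> block_upper_triangular ks" "Y \<in> block_upper_triangular ks"
    and "(\<forall>X \<in> block_upper_triangular ks. \<forall>Y \<in> block_upper_triangular ks. \<phi> (X * Y) = \<phi> X * \<phi> Y) \<or>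
      (\<forall>X \<in> block_upper_triangular ks. \<forall>Y \<in> block_upper_triangular ks. \<phi> (X * Y) = \<phi> Y * \<phi> X)"
  shows "\<phi> (jordan_prod X Y) = jordan_prod (\<phi> X) (\<phi> Y)"
proof -
  note eq = block_upper_triangular_eq_cut_algebra
  have mem: "X * Y \<in> block_upper_triangular ks" "Y * X \<in> block_upper_triangular ks"
    using assms(2,3) cut_algebra_mult[OF cuts_bounds(1)] unfolding eq by blast+
  have "\<phi> X \<in> block_upper_triangular ls" "\<phi> Y \<in> block_upper_triangular ls"
    using assms(1-3) by (auto simp: linear_bij_def dest: bij_betwE)
  then have comm: "\<phi> Y * \<phi> X + \<phi> X * \<phi> Y = \<phi> X * \<phi> Y + \<phi> Y * \<phi> X"
    unfolding eq by (intro comm_add_mat) (auto dest!: cut_algebra_carrier)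
  have sum: "\<phi> (jordan_prod X Y) = \<phi> (X * Y) + \<phi> (Y * X)"
    using assms(1) mem by (simp add: jordan_prod_def linear_bij_def)
  show ?thesis
    using assms(4)
  proof
    assume *: "\<forall>X \<in> block_upper_triangular ks. \<forall>Y \<in> block_upper_triangular ks. \<phi> (X * Y) = \<phi> X * \<phi> Y"
    show ?thesis unfolding sum unfolding jordan_prod_def using * assms(2,3) by simp
  next
    assume *: "\<forall>X \<in> block_upper_triangular ks. \<forall>Y \<in> block_upper_triangular ks. \<phi> (X * Y) = \<phi> Y * \<phi> X"
    have "\<phi> (X * Y) = \<phi> Y * \<phi> X" "\<phi> (Y * X) = \<phi> X * \<phi> Y"
      using * assms(2,3) by blast+
    then show ?thesis unfolding sum unfolding jordan_prod_def by (simp only: comm)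
  qed
qed

lemma algebra_isomorphic_refl: "algebra_isomorphic A A"
  unfolding algebra_isomorphic_def linear_bij_def by (intro exI[of _ "\<lambda>x. x"]) (simp add: bij_betw_def)

lemma jordan_isomorphic_refl: "jordan_isomorphic A A"
  unfolding jordan_isomorphic_def linear_bij_def by (intro exI[of _ "\<lambda>x. x"]) (simp add: bij_betw_def)

lemma algebra_antiisomorphic_rev:
  "algebra_antiisomorphic (block_upper_triangular (rev ks)) (block_upper_triangular ks)"
proof -
  have "linear_bij (block_upper_triangular (rev ks)) (block_upper_triangular ks) (anti_transpose (sum_list ks))"
    using linear_bij_anti_transpose[OF cuts_bounds(1)[of "rev ks"]] cuts_rev[of "rev ks"]
    by (simp add: block_upper_triangular_eq_cut_algebra)
  moreover have "anti_transpose (sum_list ks) (X * Y)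
      = anti_transpose (sum_list ks) Y * anti_transpose (sum_list ks) X"
    if "X \<in> block_upper_triangular (rev ks)" "Y \<in> block_upper_triangular (rev ks)" for X Y
    using that anti_transpose_mult by (auto simp: block_upper_triangular_def)
  ultimately show ?thesis unfolding algebra_antiisomorphic_def by blast
qed

lemma algebra_isomorphic_imp_eq:
  assumes "composition_of ks n" "composition_of ls n"
    and "algebra_isomorphic (block_upper_triangular ks) (block_upper_triangular ls)"
  shows "ks = ls"
proof -
  obtain \<phi> where \<phi>: "linear_bij (block_upper_triangular ks) (block_upper_triangular ls) \<phi>"
      "\<forall>X \<in> block_upper_triangular ks. \<forall>Y \<in> block_upper_triangular ks. \<phi> (X * Y) = \<phi> X * \<phi> Y"
    using assms(3) by (auto simp: algebra_isomorphic_def)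
  have sums: "sum_list ks = n" "sum_list ls = n"
    using assms by (auto simp: composition_of_def)
  interpret jordan_iso n "cuts ks" "\<lambda>i. unit_mat n i i" "cuts ls" \<phi>
    using hom_or_antihom_preserves_jordan_prod \<phi> by (intro jordan_iso_unit_frame sums) blast+
  have "cuts ks = cuts ls"
    using cuts_eq_if_linked_eq[OF idempotent_frame_axioms image_frame] linked_if_mult \<phi>(2) sums
    unfolding block_upper_triangular_eq_cut_algebra by blast
  then show ?thesis
    using assms by (intro cuts_inject) (auto simp: composition_of_def)
qed

lemma algebra_antiisomorphic_imp_eq_rev:
  assumes "composition_of ks n" "composition_of ls n"
    and "algebra_antiisomorphic (block_upper_triangular ks) (block_upper_triangular ls)"
  shows "ks = rev ls"
proof -
  obtain \<phi> where \<phi>: "linear_bij (block_upper_triangular ks) (block_upper_triangular ls) \<phi>"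
      "\<forall>X \<in> block_upper_triangular ks. \<forall>Y \<in> block_upper_triangular ks. \<phi> (X * Y) = \<phi> Y * \<phi> X"
    using assms(3) by (auto simp: algebra_antiisomorphic_def)
  have sums: "sum_list ks = n" "sum_list ls = n"
    using assms by (auto simp: composition_of_def)
  interpret jordan_iso n "cuts ks" "\<lambda>i. unit_mat n i i" "cuts ls" \<phi>
    using hom_or_antihom_preserves_jordan_prod \<phi> by (intro jordan_iso_unit_frame sums) blast+
  have "cuts ks = (-) n ` cuts ls"
    using cuts_reflected_if_linked_reversed[OF idempotent_frame_axioms image_frame] linked_if_antimult \<phi>(2) sums
    unfolding block_upper_triangular_eq_cut_algebra by blast
  \<comment> \<open>By \<open>cuts_rev\<close> the reflected cuts are those of
    \<open>rev ls\<close>, so injectivity applies to \<open>ks\<close> and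
    \<open>rev ls\<close>.\<close>
  then show ?thesis
    using assms sums by (intro cuts_inject) (auto simp: composition_of_def cuts_rev)
qed

lemma jordan_isomorphic_imp_eq_or_eq_rev:
  assumes "composition_of ks n" "composition_of ls n"
    and "jordan_isomorphic (block_upper_triangular ks) (block_upper_triangular ls)"
  shows "ks = ls \<or> ks = rev ls"
proof -
  obtain \<phi> where \<phi>: "linear_bij (block_upper_triangular ks) (block_upper_triangular ls) \<phi>"
      "\<forall>X \<in> block_upper_triangular ks. \<forall>Y \<in> block_upper_triangular ks.
        \<phi> (jordan_prod X Y) = jordan_prod (\<phi> X) (\<phi> Y)"
    using assms(3) by (auto simp: jordan_isomorphic_def)
  have sums: "sum_list ks = n" "sum_list ls = n"
    using assms by (auto simp: composition_of_def)
  interpret jordan_iso n "cuts ks" "\<lambda>i. unit_mat n i i" "cuts ls" \<phi>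
    using \<phi> by (intro jordan_iso_unit_frame sums) blast+
  have "(\<forall>i\<in>{..<n}. \<forall>j\<in>{..<n}. target.linked i j \<longleftrightarrow> linked i j)
      \<or> (\<forall>i\<in>{..<n}. \<forall>j\<in>{..<n}. target.linked i j \<longleftrightarrow> linked j i)"
  proof (rule betweenness_determines_preorder)
    fix i j k assume N: "i \<in> {..<n}" "j \<in> {..<n}" "k \<in> {..<n}"
    show "linked i j \<or> linked j i" "target.linked i j \<or> target.linked j i"
      using N linked_total target.linked_total by auto
    show "linked i j \<Longrightarrow> linked j k \<Longrightarrow> linked i k"
      "target.linked i j \<Longrightarrow> target.linked j k \<Longrightarrow> target.linked i k"
      using N linked_trans target.linked_trans unfolding lessThan_iff by blast+
    show "i \<noteq> j \<Longrightarrow> j \<noteq> k \<Longrightarrow>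
      (target.linked i j \<and> target.linked j k) \<or> (target.linked k j \<and> target.linked j i)
        \<longleftrightarrow> (linked i j \<and> linked j k) \<or> (linked k j \<and> linked j i)"
      using N betweenness by simp
  qed
  then show ?thesis
  proof
    assume "\<forall>i\<in>{..<n}. \<forall>j\<in>{..<n}. target.linked i j \<longleftrightarrow> linked i j"
    then have "cuts ks = cuts ls"
      by (intro cuts_eq_if_linked_eq[OF idempotent_frame_axioms image_frame]) auto
    then have "ks = ls"
      using assms by (intro cuts_inject) (auto simp: composition_of_def)
    then show ?thesis ..
  next
    assume "\<forall>i\<in>{..<n}. \<forall>j\<in>{..<n}. target.linked i j \<longleftrightarrow> linked j i"
    then have "cuts ks = (-) n ` cuts ls"
      by (intro cuts_reflected_if_linked_reversed[OF idempotent_frame_axioms image_frame]) auto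
    then have "ks = rev ls"
      using assms sums by (intro cuts_inject) (auto simp: composition_of_def cuts_rev)
    then show ?thesis ..
  qed
qed

theorem corollary3p3:
  fixes n :: nat and ks ls :: "nat list"
  assumes "0 < n"
    and "composition_of ks n"
    and "composition_of ls n"
  shows "(algebra_isomorphic (block_upper_triangular ks) (block_upper_triangular ls) \<longleftrightarrow> ks = ls) \<and>
    (algebra_antiisomorphic (block_upper_triangular ks) (block_upper_triangular ls) \<longleftrightarrow> ks = rev ls) \<and>
    (jordan_isomorphic (block_upper_triangular ks) (block_upper_triangular ls) \<longleftrightarrow> ks = ls \<or> ks = rev ls)"
proof (intro conjI iffI)
  let ?A = "block_upper_triangular ks" and ?B = "block_upper_triangular ls"
  \<comment> \<open>This supplies the Jordan isomorphism in the reversed case, where the reflection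
    in the antidiagonal gives an antiisomorphism.\<close>
  have anti: "jordan_isomorphic ?A ?B" if "algebra_antiisomorphic ?A ?B"
  proof -
    obtain \<phi> where \<phi>: "linear_bij ?A ?B \<phi>" "\<forall>X\<in>?A. \<forall>Y\<in>?A. \<phi> (X * Y) = \<phi> Y * \<phi> X"
      using \<open>algebra_antiisomorphic ?A ?B\<close> by (auto simp: algebra_antiisomorphic_def)
    show ?thesis
      unfolding jordan_isomorphic_def using \<phi> hom_or_antihom_preserves_jordan_prod[OF \<phi>(1)] by blast
  qed
  show "algebra_isomorphic ?A ?B" if "ks = ls"
    using algebra_isomorphic_refl that by simp
  show "algebra_antiisomorphic ?A ?B" if "ks = rev ls"
    using algebra_antiisomorphic_rev that by simp
  show "jordan_isomorphic ?A ?B" if "ks = ls \<or> ks = rev ls"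
    using that
  proof
    assume "ks = ls"
    show ?thesis unfolding \<open>ks = ls\<close> by (rule jordan_isomorphic_refl)
  next
    assume "ks = rev ls"
    show ?thesis unfolding \<open>ks = rev ls\<close>
      by (rule anti[unfolded \<open>ks = rev ls\<close>]) (rule algebra_antiisomorphic_rev)
  qed
qed (use assms(2,3) algebra_isomorphic_imp_eq algebra_antiisomorphic_imp_eq_rev
    jordan_isomorphic_imp_eq_or_eq_rev in blast)+

end
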